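(* For $z\in\mathbb{C}$ with $|z|<1$, $$E^3(z)=\frac{\pi^3}{8}F^3\left(-\tfrac12,\tfrac12;1;z^2\right)=\frac{\pi^3}{8}\sum_{n=0}^\infty v_n z^{2n},$$ where $v_0=1$, $v_1=-3/4$, $v_2=3/64$ and, for all $n\ge 2$, $$\begin{aligned}v_{n+1}={}&\frac{2n\left(6n^3-5n-5\right)-3}{4(n+1)^4}v_n-\frac{8n(2n(3(n-4)n+13)-9)+29}{16(n+1)^4}v_{n-1}\\&+\frac{(2n-7)(2n-5)(2n-3)(2n-1)}{16(n+1)^4}v_{n-2}.\end{aligned}$$
   Context: $E(z)=\int_0^{\pi/2}\sqrt{1-z^2\sin^2\theta}\,d\theta$, $|z|<1$ (principal square root), is the complete elliptic integral of the second kind, and $E^3(z)=(E(z))^3$. $F(a,b;c;z)=\sum_{k=0}^\infty \frac{(a)_k(b)_k}{(c)_k\,k!}z^k$, $|z|<1$, is the Gaussian hypergeometric function, with $(x)_k=x(x+1)\cdots(x+k-1)$, $(x)_0=1$; $F^3$ denotes its cube. *)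

theory Defs
  imports "HOL-Analysis.Analysis"
begin

text \<open>
  The complete elliptic integral of the second kind, as a function of the modulus \<open>z\<close>.
  It is only meant for \<open>norm z < 1\<close>, where the argument of the principal square root
  \<^const>\<open>csqrt\<close> stays in the open right half-plane and the integrand is continuous.
\<close>

definition ellE :: "complex \<Rightarrow> complex" where
  "ellE z = integral {0..pi/2} (\<lambda>\<theta>. csqrt (1 - z\<^sup>2 * (complex_of_real (sin \<theta>))\<^sup>2))"

text \<open>
  The Gaussian hypergeometric function. It is only meant for \<open>norm z < 1\<close> and \<open>c\<close> not a
  nonpositive integer; elsewhere the value is the one that \<^const>\<open>suminf\<close> and division by
  zero happen to give. The formal power series \<^const>\<open>fps_hypergeo\<close> of the library has
  the same coefficients for the arguments \<open>[a, b]\<close>, \<open>[c]\<close> and \<open>1\<close>.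
\<close>

definition hyp2F1 :: "complex \<Rightarrow> complex \<Rightarrow> complex \<Rightarrow> complex \<Rightarrow> complex" where
  "hyp2F1 a b c z =
     (\<Sum>k. pochhammer a k * pochhammer b k / (pochhammer c k * fact k) * z ^ k)"

end

theory Submission
  imports Defs
begin

text \<open>
  Put \<open>x = z\<^sup>2\<close> and let \<open>\<theta> = x d/dx\<close> be the Euler operator, which multiplies the \<open>n\<close>-th
  coefficient of a power series by \<open>n\<close>. The series \<open>y = F(-1/2, 1/2; 1; x)\<close> satisfies
  \<open>(1 - x) \<theta>\<^sup>2 y = -(x/4) y\<close>. There is no first-order term, so this reads \<open>\<theta>\<^sup>2 y = q y\<close>
  with \<open>q\<close> a rational function whose only pole is at \<open>1\<close>. The span of
  \<open>y\<^sup>3\<close>, \<open>y\<^sup>2 \<theta>y\<close>, \<open>y (\<theta>y)\<^sup>2\<close>, \<open>(\<theta>y)\<^sup>3\<close> over the rational functions is then closed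
  under \<open>\<theta>\<close>, so that \<open>w = y\<^sup>3\<close> solves a linear equation of order four,
    \<open>\<theta>\<^sup>4 w = 10 q \<theta>\<^sup>2 w + 10 (\<theta>q) \<theta>w + (3 \<theta>\<^sup>2 q - 9 q\<^sup>2) w\<close>
  (lemma \<open>fps_XD_cube\<close>). Multiplying by \<open>(1 - x)\<^sup>3\<close> makes its coefficients polynomials of degree at
  most three in \<open>x\<close> (lemma \<open>fps_XD_cube_rational\<close>). Comparing coefficients of \<open>x ^ (n + 1)\<close> gives
  the four-term recurrence, which together with the first three coefficients determines \<open>v\<close>.

  The analytic part expands the integrand of \<open>E\<close> by the binomial series. It converges uniformly in the
  angle because \<open>norm (z\<^sup>2 sin\<^sup>2 t) \<le> norm z ^ 2 < 1\<close>, and Wallis's integral evaluates each term.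
  The coefficients of both series are bounded by \<open>1\<close> in norm (lemma \<open>norm_pochhammer_le_fact\<close>); hence \<open>y\<close>
  and its formal cube converge in the unit disc, and the formal cube evaluates to the cube of the value.
\<close>

section \<open>The differential equation for the cube of a solution\<close>

lemma fps_XD_mult:
  fixes f g :: "'a::comm_ring_1 fps"
  shows "fps_XD (f * g) = fps_XD f * g + f * fps_XD g"
  by (simp add: fps_XD_def algebra_simps)

lemma fps_XD_diff:
  fixes f g :: "'a::comm_ring_1 fps"
  shows "fps_XD (f - g) = fps_XD f - fps_XD g"
  by (simp add: fps_XD_def algebra_simps)

lemma fps_XD_const_X [simp]:
  "fps_XD (fps_const c) = (0 :: 'a::comm_ring_1 fps)"
  "fps_XD (fps_X :: 'a::comm_ring_1 fps) = fps_X"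
  "fps_XD (numeral k :: 'a::comm_ring_1 fps) = 0"
  "fps_XD (1 :: 'a::comm_ring_1 fps) = 0"
  by (simp_all add: fps_XD_def)

text \<open>
  This is the symmetric cube of the operator \<open>\<theta>\<^sup>2 - q\<close>. With \<open>B = y\<^sup>2 \<theta>y\<close>, \<open>C = y (\<theta>y)\<^sup>2\<close> and
  \<open>D = (\<theta>y)\<^sup>3\<close> one has \<open>\<theta>w = 3 B\<close>, \<open>\<theta>B = 2 C + q w\<close>, \<open>\<theta>C = D + 2 q B\<close> and \<open>\<theta>D = 3 q C\<close>.
  The fourth derivative of \<open>w\<close> contains no \<open>D\<close>, and \<open>B\<close>, \<open>C\<close> are eliminated through
  \<open>\<theta>w\<close> and \<open>\<theta>\<^sup>2 w = 6 C + 3 q w\<close>.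
\<close>

lemma fps_XD_cube:
  fixes y q :: "'a::field_char_0 fps"
  assumes y: "fps_XD (fps_XD y) = q * y"
  defines "w \<equiv> y ^ 3"
  shows "fps_XD (fps_XD (fps_XD (fps_XD w)))
    = 10 * q * fps_XD (fps_XD w) + 10 * fps_XD q * fps_XD w
      + (3 * fps_XD (fps_XD q) - 9 * q\<^sup>2) * w"
  unfolding w_def power3_eq_cube power2_eq_square
  by (simp add: fps_XD_mult y) (simp add: algebra_simps)

text \<open>
  Here \<open>q = c x s\<close> with \<open>s = 1 / (1 - x)\<close>. Since \<open>\<theta>s = x s\<^sup>2\<close>, one finds \<open>\<theta>q = c x s\<^sup>2\<close> and
  \<open>\<theta>\<^sup>2 q = c x (1 + x) s\<^sup>3\<close>, so the third power of \<open>1 - x\<close> clears all denominators.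
\<close>

lemma fps_XD_cube_rational:
  fixes y :: "'a::field_char_0 fps" and c :: 'a
  assumes y: "(1 - fps_X) * fps_XD (fps_XD y) = fps_const c * fps_X * y"
  defines "w \<equiv> y ^ 3"
  shows "(1 - fps_X) ^ 3 * fps_XD (fps_XD (fps_XD (fps_XD w)))
    = 10 * fps_const c * fps_X * (1 - fps_X)\<^sup>2 * fps_XD (fps_XD w)
      + 10 * fps_const c * fps_X * (1 - fps_X) * fps_XD w
      + (3 * fps_const c * fps_X * (1 + fps_X)
          - 9 * (fps_const c)\<^sup>2 * fps_X\<^sup>2 * (1 - fps_X)) * w"
proof -
  define s where "s = inverse (1 - fps_X :: 'a fps)"
  define q where "q = fps_const c * fps_X * s"
  have s: "(1 - fps_X) * s = 1"
    unfolding s_def by (subst mult.commute) (rule inverse_mult_eq_1, simp)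
  have "fps_XD ((1 - fps_X) * s) = 0"
    by (simp add: s)
  then have "(1 - fps_X) * fps_XD s = fps_X * s"
    by (simp only: fps_XD_mult fps_XD_diff fps_XD_const_X) (simp add: algebra_simps)
  with s have Ds: "fps_XD s = fps_X * s\<^sup>2" by algebra
  have yq: "fps_XD (fps_XD y) = q * y"
    using y s unfolding q_def by algebra
  have "fps_XD q = fps_const c * (fps_X * s + fps_X\<^sup>2 * s\<^sup>2)"
    by (simp add: q_def fps_XD_mult Ds algebra_simps power2_eq_square)
  with s have Dq: "fps_XD q = fps_const c * fps_X * s\<^sup>2" by algebra
  have "fps_XD (fps_XD q) = fps_const c * (fps_X * s\<^sup>2 + 2 * fps_X\<^sup>2 * s ^ 3)"
    unfolding Dq power2_eq_square power3_eq_cube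
    by (simp add: fps_XD_mult Ds power2_eq_square algebra_simps)
  with s have DDq: "fps_XD (fps_XD q) = fps_const c * fps_X * (1 + fps_X) * s ^ 3" by algebra
  define u where "u = (1 - fps_X :: 'a fps)"
  have us: "u * s = 1" using s by (simp add: u_def)
  have 1: "u ^ 3 * q = fps_const c * fps_X * u\<^sup>2" 
    using us unfolding q_def by algebra
  have 2: "u ^ 3 * fps_XD q = fps_const c * fps_X * u"
    using us unfolding Dq by algebra
  have 3: "u ^ 3 * fps_XD (fps_XD q) = fps_const c * fps_X * (1 + fps_X)"
    using us unfolding DDq by algebra
  have 4: "u ^ 3 * q\<^sup>2 = (fps_const c)\<^sup>2 * fps_X\<^sup>2 * u"
    using us unfolding q_def by algebra
  have "u ^ 3 * fps_XD (fps_XD (fps_XD (fps_XD w))) =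
      10 * (u ^ 3 * q) * fps_XD (fps_XD w) + 10 * (u ^ 3 * fps_XD q) * fps_XD w
      + (3 * (u ^ 3 * fps_XD (fps_XD q)) - 9 * (u ^ 3 * q\<^sup>2)) * w"
    unfolding w_def fps_XD_cube[OF yq] by (simp add: algebra_simps)
  also note 1 also note 2 also note 3 also note 4
  finally show ?thesis by (simp add: u_def mult.assoc)
qed

section \<open>The power series of the complete elliptic integral\<close>

text \<open>
  The series of \<open>2 E(z) / \<pi>\<close> in the variable \<open>z\<^sup>2\<close>. The coefficient field is left open, so that the
  algebraic part uses nothing about convergence.
\<close>

definition ellE_fps :: "'a::field_char_0 fps" where
  "ellE_fps = Abs_fps (\<lambda>k. pochhammer (- 1 / 2) k * pochhammer (1 / 2) k / (pochhammer 1 k * fact k))"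

text \<open>
  The quotient of consecutive coefficients is \<open>(m - 1/2) (m + 1/2) / (m + 1)\<^sup>2\<close>. The numerator is
  \<open>m\<^sup>2 - 1/4\<close>, so the first-order terms cancel and the shape \<open>\<theta>\<^sup>2 y = q y\<close> results.
\<close>

lemma ellE_fps_ODE:
  "(1 - fps_X) * fps_XD (fps_XD ellE_fps) = fps_const (- 1 / 4 :: 'a::field_char_0) * fps_X * ellE_fps"
proof (rule fps_ext)
  fix n
  show "fps_nth ((1 - fps_X) * fps_XD (fps_XD ellE_fps)) n = fps_nth (fps_const (- 1 / 4 :: 'a) * fps_X * ellE_fps) n"
  proof (cases n)
    case (Suc m)
    let ?a = "ellE_fps :: 'a fps"
    have ne: "of_nat m + (1::'a) \<noteq> 0" by (metis of_nat_Suc of_nat_neq_0 add.commute)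
    have "(of_nat m + 1)\<^sup>2 * fps_nth ?a (Suc m) = ((of_nat m)\<^sup>2 - 1 / 4) * fps_nth ?a m"
      using ne by (simp add: ellE_fps_def pochhammer_rec' pochhammer_fact[symmetric] divide_simps power2_eq_square)
        (simp add: algebra_simps)
    then show ?thesis
      by (simp add: Suc left_diff_distrib mult.assoc power2_eq_square) (simp add: algebra_simps)
  qed (simp add: left_diff_distrib mult.assoc)
qed

text \<open>
  The fourth-order equation for \<open>c = -1/4\<close>, multiplied by \<open>16\<close> and sorted by powers of \<open>x\<close>, read off
  at the coefficient of \<open>x ^ (n + 1)\<close>. The factorisation of the last coefficient comes from
  \<open>16 k\<^sup>4 - 40 k\<^sup>2 + 9 = (4 k\<^sup>2 - 1) (4 k\<^sup>2 - 9)\<close> with \<open>k = n - 2\<close>.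
\<close>

lemma ellE_cube_recurrence:
  fixes n :: nat
  defines "w \<equiv> \<lambda>k. fps_nth (ellE_fps ^ 3 :: 'a::field_char_0 fps) k"
    and "x \<equiv> of_nat n :: 'a"
  assumes "n \<ge> 2"
  shows "16 * (x + 1) ^ 4 * w (n + 1) =
      4 * (2 * x * (6 * x ^ 3 - 5 * x - 5) - 3) * w n
    - (8 * x * (2 * x * (3 * (x - 4) * x + 13) - 9) + 29) * w (n - 1)
    + (2 * x - 7) * (2 * x - 5) * (2 * x - 3) * (2 * x - 1) * w (n - 2)"
proof -
  define W where "W = (ellE_fps ^ 3 :: 'a fps)"
  let ?D = "fps_XD :: 'a fps \<Rightarrow> 'a fps"
  have "fps_const 16 * ?D (?D (?D (?D W))) =
      fps_X * (fps_const 48 * ?D (?D (?D (?D W))) - fps_const 40 * ?D (?D W)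
            - fps_const 40 * ?D W - fps_const 12 * W)
    + fps_X ^ 2 * (fps_const 80 * ?D (?D W) + fps_const 40 * ?D W - fps_const 21 * W
            - fps_const 48 * ?D (?D (?D (?D W))))
    + fps_X ^ 3 * (fps_const 16 * ?D (?D (?D (?D W))) - fps_const 40 * ?D (?D W) + fps_const 9 * W)"
    (is "?L = ?R")
  proof -
    have c: "4 * fps_const (- 1 / 4) = (- 1 :: 'a fps)"
      by (simp add: numeral_fps_const flip: fps_const_neg fps_const_1_eq_1)
    show ?thesis
      using fps_XD_cube_rational[OF ellE_fps_ODE, where 'a = 'a, folded W_def] c
      unfolding numeral_fps_const[symmetric] by algebra
  qed
  then have *: "fps_nth ?L (n + 1) = fps_nth ?R (n + 1)"
    by (rule arg_cong)
  obtain m where n: "n = m + 2"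
    using assms(3) le_Suc_ex by (metis add.commute)
  show ?thesis
    using * unfolding w_def x_def W_def[symmetric] n
    by (simp add: fps_X_power_mult_nth numeral_3_eq_3 numeral_2_eq_2)
      (simp add: algebra_simps power_numeral_reduce)
qed

lemma ellE_cube_initial:
  "fps_nth (ellE_fps ^ 3 :: 'a::field_char_0 fps) 0 = 1"
  "fps_nth (ellE_fps ^ 3 :: 'a::field_char_0 fps) 1 = - 3 / 4"
  "fps_nth (ellE_fps ^ 3 :: 'a::field_char_0 fps) 2 = 3 / 64"
proof -
  have a: "fps_nth (ellE_fps :: 'a fps) 0 = 1" "fps_nth (ellE_fps :: 'a fps) (Suc 0) = - 1 / 4"
    "fps_nth (ellE_fps :: 'a fps) (Suc (Suc 0)) = - 3 / 64"
    by (simp_all add: ellE_fps_def pochhammer_Suc)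
  show "fps_nth (ellE_fps ^ 3 :: 'a fps) 0 = 1"
    "fps_nth (ellE_fps ^ 3 :: 'a fps) 1 = - 3 / 4"
    "fps_nth (ellE_fps ^ 3 :: 'a fps) 2 = 3 / 64"
    by (simp_all add: power3_eq_cube numeral_2_eq_2 fps_mult_nth a)
qed

section \<open>Expansion of the elliptic integral\<close>

text \<open>
  The factors \<open>a + k\<close> of the rising factorial are dominated by the factors \<open>1 + k\<close> of the factorial.
  This gives the summable majorants for the binomial series and for the hypergeometric series.
\<close>

lemma norm_pochhammer_le_fact:
  fixes a :: "'a::{real_normed_algebra_1,comm_semiring_1}"
  assumes "norm a \<le> 1"
  shows "norm (pochhammer a n) \<le> fact n"
proof (induction n)
  case (Suc n)
  have "norm (a + of_nat n) \<le> 1 + real n"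
    using norm_triangle_ineq[of a "of_nat n"] assms by simp
  then have "norm (pochhammer a n) * norm (a + of_nat n) \<le> fact n * (1 + real n)"
    using Suc by (intro mult_mono) auto
  then show ?case
    using norm_mult_ineq[of "pochhammer a n" "a + of_nat n"]
    by (simp add: pochhammer_Suc algebra_simps)
qed simp

text \<open>
  The recursion \<open>(m + 2) \<integral> sin ^ (m + 2) = (m + 1) \<integral> sin ^ m\<close> holds because the derivative of
  \<open>- cos t * sin t ^ (m + 1)\<close> is the difference of the two integrands, and this function vanishes at both
  ends of the interval.
\<close>

lemma wallis_integral:
  "((\<lambda>t. sin t ^ (2 * k)) has_integral (pi / 2 * pochhammer (1 / 2) k / fact k)) {0..pi / 2}"
proof (induction k)
  case 0
  then show ?case using has_integral_const_real[of "1::real" 0 "pi/2"] by simp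
next
  case (Suc k)
  define m where "m = 2 * k"
  have deriv: "((\<lambda>t. - (cos t * sin t ^ (m + 1))) has_vector_derivative
      (real m + 2) * sin t ^ (m + 2) - (real m + 1) * sin t ^ m) (at t within {0..pi / 2})" for t :: real
  proof -
    have "((\<lambda>t. - (cos t * sin t ^ (m + 1))) has_real_derivative
        sin t * sin t ^ (m + 1) - cos t * ((real m + 1) * sin t ^ m * cos t)) (at t within {0..pi / 2})"
      by (rule derivative_eq_intros refl)+ (simp add: algebra_simps)
    also have "sin t * sin t ^ (m + 1) - cos t * ((real m + 1) * sin t ^ m * cos t)
        = sin t ^ (m + 2) - (real m + 1) * sin t ^ m * (cos t)\<^sup>2"
      by (simp add: power2_eq_square)
    also have "\<dots> = (real m + 2) * sin t ^ (m + 2) - (real m + 1) * sin t ^ m"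
      unfolding cos_squared_eq by (simp add: power2_eq_square algebra_simps)
    finally show ?thesis
      by (simp add: has_real_derivative_iff_has_vector_derivative)
  qed
  have "((\<lambda>t. (real m + 2) * sin t ^ (m + 2) - (real m + 1) * sin t ^ m) has_integral 0) {0..pi / 2}"
    using fundamental_theorem_of_calculus[OF _ deriv] by simp
  from has_integral_add[OF this has_integral_mult_right[OF Suc.IH[folded m_def], of "real m + 1"]]
  have "((\<lambda>t. (real m + 2) * sin t ^ (m + 2)) has_integral
      (real m + 1) * (pi / 2 * pochhammer (1 / 2) k / fact k)) {0..pi / 2}"
    by simp
  from has_integral_mult_right[OF this, of "1 / (real m + 2)"]
  have "((\<lambda>t. sin t ^ (m + 2)) has_integral
      (real m + 1) / (real m + 2) * (pi / 2 * pochhammer (1 / 2) k / fact k)) {0..pi / 2}"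
    by (simp add: add_eq_0_iff)
  also have "(real m + 1) / (real m + 2) * (pi / 2 * pochhammer (1 / 2) k / fact k)
      = pi / 2 * pochhammer (1 / 2) (Suc k) / fact (Suc k)"
    by (simp add: m_def pochhammer_Suc divide_simps) (simp add: algebra_simps)
  finally show ?case by (simp add: m_def)
qed

lemma csqrt_one_minus_sums:
  assumes "norm u < 1"
  shows "(\<lambda>k. pochhammer (- 1 / 2) k / fact k * u ^ k) sums csqrt (1 - u)"
proof -
  have "((1 / 2) gchoose k) * (- u) ^ k = pochhammer (- 1 / 2) k / fact k * u ^ k" for k
  proof -
    have "((1 / 2) gchoose k) * (- u) ^ k = pochhammer (- (1 / 2)) k / fact k * ((- 1) ^ k * (- u) ^ k)"
      unfolding gbinomial_pochhammer by (simp only: mult_ac times_divide_eq_right times_divide_eq_left)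
    also have "(- 1) ^ k * (- u) ^ k = u ^ k"
      by (subst power_mult_distrib[symmetric]) simp
    finally show ?thesis
      by (simp only: minus_divide_left)
  qed
  moreover have "(\<lambda>k. ((1 / 2) gchoose k) * (- u) ^ k) sums (1 + (- u)) powr (1 / 2)"
    by (rule gen_binomial_complex) (use assms in simp)
  ultimately show ?thesis
    by (simp only: csqrt_conv_powr diff_conv_add_uminus)
qed

text \<open>
  Weierstrass's test with the majorant \<open>norm z ^ (2 * k)\<close> allows the binomial series of the integrand
  to be integrated term by term.
\<close>

lemma sums_ellE:
  assumes z: "norm z < 1"
  shows "(\<lambda>k. of_real (pi / 2) * fps_nth ellE_fps k * (z\<^sup>2) ^ k) sums ellE z"
proof -
  define f where "f = (\<lambda>k t. pochhammer (- 1 / 2) k / fact k * (z\<^sup>2 * (complex_of_real (sin t))\<^sup>2) ^ k)"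
  define g where "g = (\<lambda>t. csqrt (1 - z\<^sup>2 * (complex_of_real (sin t))\<^sup>2))"
  have bound: "norm (z\<^sup>2 * (complex_of_real (sin t))\<^sup>2) \<le> (norm z)\<^sup>2" for t
    using mult_left_mono[of "(sin t)\<^sup>2" 1 "(norm z)\<^sup>2"] 
    by (simp add: norm_mult norm_power abs_square_le_1)
  have z2: "(norm z)\<^sup>2 < 1"
    using z by (simp add: abs_square_less_1)
  have sums: "(\<lambda>k. f k t) sums g t" for t
    unfolding f_def g_def by (intro csqrt_one_minus_sums le_less_trans[OF bound z2])
  have "uniform_limit {0..pi / 2} (\<lambda>n t. \<Sum>k<n. f k t) (\<lambda>t. suminf (\<lambda>k. f k t)) sequentially"
  proof (rule Weierstrass_m_test)
    fix k t
    have "norm (pochhammer (- 1 / 2 :: complex) k / fact k) \<le> 1"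
      using norm_pochhammer_le_fact[of "- 1 / 2 :: complex" k] by (simp add: norm_divide)
    then have "norm (pochhammer (- 1 / 2 :: complex) k / fact k)
        * norm (z\<^sup>2 * (complex_of_real (sin t))\<^sup>2) ^ k \<le> 1 * ((norm z)\<^sup>2) ^ k"
      by (intro mult_mono power_mono bound) auto
    then show "norm (f k t) \<le> ((norm z)\<^sup>2) ^ k"
      unfolding f_def by (simp only: norm_mult[of "_ / _"] norm_power[of _ k] mult_1)
    show "summable (\<lambda>k. ((norm z)\<^sup>2) ^ k)"
      using z2 by (intro summable_geometric) simp
  qed
  then have "uniform_limit {0..pi / 2} (\<lambda>n t. \<Sum>k<n. f k t) g sequentially"
    using sums by (simp add: sums_iff)
  moreover have "continuous_on {0..pi / 2} (\<lambda>t. \<Sum>k<n. f k t)" for n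
    unfolding f_def by (intro continuous_intros)
  ultimately obtain I J where I: "\<And>n. ((\<lambda>t. \<Sum>k<n. f k t) has_integral I n) {0..pi / 2}"
    and J: "(g has_integral J) {0..pi / 2}" and lim: "I \<longlonglongrightarrow> J"
    by (rule uniform_limit_integral) auto
  let ?c = "\<lambda>k. of_real (pi / 2) * fps_nth ellE_fps k * (z\<^sup>2) ^ k"
  have "(f k has_integral ?c k) {0..pi / 2}" for k
  proof -
    have "((\<lambda>t. pochhammer (- 1 / 2) k / fact k * (z\<^sup>2) ^ k * complex_of_real (sin t ^ (2 * k))) has_integral
        pochhammer (- 1 / 2) k / fact k * (z\<^sup>2) ^ k * of_real (pi / 2 * pochhammer (1 / 2) k / fact k)) {0..pi / 2}"
      by (intro has_integral_mult_right has_integral_of_real wallis_integral)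
    moreover have "f k = (\<lambda>t. pochhammer (- 1 / 2) k / fact k * (z\<^sup>2) ^ k * complex_of_real (sin t ^ (2 * k)))"
      by (simp add: f_def fun_eq_iff power_mult_distrib flip: power_mult)
    moreover have "?c k = pochhammer (- 1 / 2) k / fact k * (z\<^sup>2) ^ k
        * of_real (pi / 2 * pochhammer (1 / 2) k / fact k)"
      using pochhammer_of_real[of "1 / 2" k, where 'a = complex]
      by (simp add: ellE_fps_def pochhammer_fact[symmetric] mult_ac)
    ultimately show ?thesis
      by (simp only:)
  qed
  then have "((\<lambda>t. \<Sum>k<n. f k t) has_integral (\<Sum>k<n. ?c k)) {0..pi / 2}" for n
    by (intro has_integral_sum) auto
  then have "I = (\<lambda>n. \<Sum>k<n. ?c k)"
    using I has_integral_unique by blast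
  moreover have "J = ellE z"
    using integral_unique[OF J] by (simp only: ellE_def g_def)
  ultimately show ?thesis
    using lim by (simp only: sums_def)
qed

section \<open>Convergence and the cube\<close>

lemma fps_conv_radius_ellE_fps: "fps_conv_radius (ellE_fps :: complex fps) \<ge> 1"
  unfolding fps_conv_radius_def
proof (rule conv_radius_geI_ex)
  fix r :: real
  assume r: "0 < r" "ereal r < 1"
  have "norm (fps_nth (ellE_fps :: complex fps) k) \<le> 1" for k
  proof -
    have "norm (pochhammer (- 1 / 2 :: complex) k) * norm (pochhammer (1 / 2 :: complex) k) \<le> fact k * fact k"
      by (intro mult_mono norm_pochhammer_le_fact) auto
    then show ?thesis
      by (simp add: ellE_fps_def norm_mult norm_divide pochhammer_fact[symmetric])
  qed
  then have le: "norm (fps_nth (ellE_fps :: complex fps) k * of_real r ^ k) \<le> r ^ k" for k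
    using r by (simp add: norm_mult norm_power mult_le_cancel_right1)
  have "summable (\<lambda>k. r ^ k)"
    using r by (intro summable_geometric) simp
  then have "summable (\<lambda>k. fps_nth (ellE_fps :: complex fps) k * of_real r ^ k)"
    by (rule summable_comparison_test'[where N = 0]) (rule le)
  then show "\<exists>z :: complex. norm z = r \<and> summable (\<lambda>k. fps_nth ellE_fps k * z ^ k)"
    using r by (intro exI[of _ "of_real r"]) simp
qed

lemma eval_fps_ellE_fps: "eval_fps ellE_fps w = hyp2F1 (- 1 / 2) (1 / 2) 1 w"
  by (simp add: eval_fps_def hyp2F1_def ellE_fps_def)

theorem corollary3p2:
  fixes z :: complex and v :: "nat \<Rightarrow> real"
  assumes z: "norm z < 1"
    and v0: "v 0 = 1"
    and v1: "v 1 = - 3 / 4"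
    and v2: "v 2 = 3 / 64"
    and v_rec: "\<And>n::nat. n \<ge> 2 \<Longrightarrow>
      v (n + 1) =
          (2 * real n * (6 * real n ^ 3 - 5 * real n - 5) - 3)
            / (4 * (real n + 1) ^ 4) * v n
        - (8 * real n * (2 * real n * (3 * (real n - 4) * real n + 13) - 9) + 29)
            / (16 * (real n + 1) ^ 4) * v (n - 1)
        + ((2 * real n - 7) * (2 * real n - 5) * (2 * real n - 3) * (2 * real n - 1))
            / (16 * (real n + 1) ^ 4) * v (n - 2)"
  shows "ellE z ^ 3 = complex_of_real (pi ^ 3 / 8) * hyp2F1 (- 1 / 2) (1 / 2) 1 (z\<^sup>2) ^ 3
    \<and> summable (\<lambda>n. complex_of_real (v n) * z ^ (2 * n))
    \<and> complex_of_real (pi ^ 3 / 8) * hyp2F1 (- 1 / 2) (1 / 2) 1 (z\<^sup>2) ^ 3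
        = complex_of_real (pi ^ 3 / 8) * (\<Sum>n. complex_of_real (v n) * z ^ (2 * n))"
proof -
  let ?W = "ellE_fps ^ 3 :: complex fps"
  let ?F = "hyp2F1 (- 1 / 2) (1 / 2) 1 (z\<^sup>2)"
  \<comment> \<open>The recurrence has order three, so it and the initial values fix the whole sequence.\<close>
  have v: "complex_of_real (v n) = fps_nth ?W n" for n
  proof (induction n rule: less_induct)
    case (less n)
    consider "n = 0" | "n = 1" | "n = 2" | m where "n = m + 1" "m \<ge> 2"
      by (metis One_nat_def Suc_1 Suc_eq_plus1 less_2_cases not_less not0_implies_Suc not_less_eq_eq le_antisym)
    then show ?case
    proof cases
      case 1
      then show ?thesis by (simp add: v0 ellE_cube_initial)
    next
      case 2
      then show ?thesis by (simp add: v1[unfolded One_nat_def] ellE_cube_initial(2)[unfolded One_nat_def])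
    next
      case 3
      then show ?thesis by (simp add: v2 ellE_cube_initial(3))
    next
      case (4 m)
      let ?x = "real m"
      have ne: "?x + 1 \<noteq> 0" by linarith
      have "16 * (?x + 1) ^ 4 * v (m + 1) =
            4 * (2 * ?x * (6 * ?x ^ 3 - 5 * ?x - 5) - 3) * v m
          - (8 * ?x * (2 * ?x * (3 * (?x - 4) * ?x + 13) - 9) + 29) * v (m - 1)
          + (2 * ?x - 7) * (2 * ?x - 5) * (2 * ?x - 3) * (2 * ?x - 1) * v (m - 2)"
      proof -
        \<comment> \<open>Clears the denominators \<open>4 N\<close> and \<open>16 N\<close>, where \<open>N\<close> is \<open>(m + 1) ^ 4\<close>.\<close>
        have clear: "16 * N * (a / (4 * N) * p - b / (16 * N) * q + c / (16 * N) * r) = 4 * a * p - b * q + c * r"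
          if "N \<noteq> 0" for N a b c p q r :: real
          using that by (simp add: field_simps)
        show ?thesis
          unfolding v_rec[OF \<open>m \<ge> 2\<close>] by (rule clear) (use ne in simp)
      qed
      from arg_cong[OF this, of complex_of_real]
      have "16 * (of_nat m + 1) ^ 4 * complex_of_real (v (m + 1)) = 16 * (of_nat m + 1) ^ 4 * fps_nth ?W (m + 1)"
        unfolding ellE_cube_recurrence[OF \<open>m \<ge> 2\<close>]
        using less.IH[of m] less.IH[of "m - 1"] less.IH[of "m - 2"] 4 by simp
      moreover have "(of_nat m + 1 :: complex) \<noteq> 0"
        by (metis of_nat_Suc of_nat_neq_0 add.commute)
      ultimately show ?thesis
        using 4 by simp
    qed
  qed
  have z2: "norm (z\<^sup>2) < 1"
    using z by (simp add: norm_power abs_square_less_1)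
  then have radius: "ereal (norm (z\<^sup>2)) < fps_conv_radius (ellE_fps :: complex fps)"
    using fps_conv_radius_ellE_fps by (metis ereal_less(3) less_le_trans)
  then have "(\<lambda>k. of_real (pi / 2) * (fps_nth ellE_fps k * (z\<^sup>2) ^ k)) sums (of_real (pi / 2) * ?F)"
    unfolding eval_fps_ellE_fps[symmetric] by (intro sums_mult sums_eval_fps)
  then have E: "ellE z = of_real (pi / 2) * ?F"
    using sums_ellE[OF z] by (simp add: mult.assoc sums_iff)
  have "ereal (norm (z\<^sup>2)) < fps_conv_radius ?W"
    using radius fps_conv_radius_power less_le_trans by blast
  then have "(\<lambda>n. fps_nth ?W n * (z\<^sup>2) ^ n) sums eval_fps ?W (z\<^sup>2)"
    by (rule sums_eval_fps)
  then have S: "(\<lambda>n. complex_of_real (v n) * z ^ (2 * n)) sums (?F ^ 3)"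
    using radius by (simp add: v eval_fps_power eval_fps_ellE_fps power_mult)
  show ?thesis
    using S by (simp add: E sums_iff power_mult_distrib power_divide)
qed

end
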